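(* The product AHI cone is not contained in the SONC cone: $\Pi_{\mathrm{AHI}}\not\subseteq\mathcal{C}_{n,2d}$. That is, there exist $n$ and $d$ and a polynomial in $\Pi_{\mathrm{AHI}}$, in $n$ variables and of degree at most $2d$, that does not belong to $\mathcal{C}_{n,2d}$.
   Context: AHI polynomials: a polynomial in $n$ variables is an AHI polynomial if it has the form $p(x)=\big(\sum_{i=1}^n \lambda_i x^{\alpha(i)}\big)\big(\sum_{i=1}^n \lambda_i \prod_{j\neq i} x^{\alpha(j)}\big)-c\prod_{i=1}^n x^{\alpha(i)}$ with $\lambda_i\ge 0$, $c\in\mathbb{R}$, and each $x^{\alpha(i)}$ a squared monomial in $x_1,\dots,x_n$ (all exponents even non-negative integers; the constant monomial $1$ is allowed). $\mathrm{AHI}$ is the set of those that are non-negative on $\mathbb{R}^n$. The product AHI cone $\Pi_{\mathrm{AHI}}$ (in $n$ variables) is the conic hull (set of finite non-negative linear combinations) of all finite products $\prod_{l=1}^k p_l$ with $k\in\mathbb{N}$, $p_1,\dots,p_k\in\mathrm{AHI}$. Circuit polynomials: a circuit polynomial is a polynomial $g=\sum_{j=0}^m b_jx^{a(j)}+c'x^{y}$ where $a(0),\dots,a(m)\in(2\mathbb{Z}_{\ge0})^n$ are affinely independent, $b_j>0$, $c'\in\mathbb{R}$, and $y\in\mathbb{Z}_{\ge 0}^n$ lies in the relative interior of the simplex $\operatorname{conv}\{a(0),\dots,a(m)\}$; monomial squares $b\,x^{a}$ with $b>0$, $a\in(2\mathbb{Z}_{\ge0})^n$ are included as a degenerate case.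 The SONC cone $\mathcal{C}_{n,2d}$ is the set of finite non-negative linear combinations of circuit polynomials in $n$ variables of degree at most $2d$ that are non-negative on $\mathbb{R}^n$. *)

theory Defs
  imports "HOL-Analysis.Analysis" "HOL-Analysis.Finite_Function_Topology"
begin

text \<open>
  Variables are numbered by the naturals, and an object "in \<open>n\<close> variables" only involves the
  variables \<open>0, \<dots>, n - 1\<close>. Thus exponent vectors in \<open>\<int>\<^sub>\<ge>\<^sub>0\<^sup>n\<close> and points of \<open>\<real>\<^sup>n\<close> are finitely supported
  functions whose support (\<open>Poly_Mapping.keys\<close>) is contained in \<open>{..<n}\<close>, and a polynomial maps an
  exponent vector to its coefficient. The ring structure on polynomials is the convolution product
  of \<open>HOL-Library.Poly_Mapping\<close>; the real vector space structure and the topology (that of the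
  \<open>\<ell>\<^sub>1\<close> norm, which is the usual one on each \<open>\<real>\<^sup>n\<close>) are those of
  \<open>HOL-Analysis.Finite_Function_Topology\<close>.
\<close>

type_synonym expo = "nat \<Rightarrow>\<^sub>0 nat"
type_synonym mpoly = "expo \<Rightarrow>\<^sub>0 real"

definition vecs :: "nat \<Rightarrow> (nat \<Rightarrow>\<^sub>0 'a::zero) set" where
  "vecs n = {v. Poly_Mapping.keys v \<subseteq> {..<n}}"

definition even_vecs :: "nat \<Rightarrow> expo set" where
  "even_vecs n = {a \<in> vecs n. \<forall>i. even (Poly_Mapping.lookup a i)}"

definition mon :: "expo \<Rightarrow> mpoly" where
  "mon a = Poly_Mapping.single a 1"

definition eval_poly :: "mpoly \<Rightarrow> (nat \<Rightarrow>\<^sub>0 real) \<Rightarrow> real" where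
  "eval_poly p x = (\<Sum>a\<in>Poly_Mapping.keys p. Poly_Mapping.lookup p a *
     (\<Prod>i\<in>Poly_Mapping.keys a. Poly_Mapping.lookup x i ^ Poly_Mapping.lookup a i))"

definition nonneg_poly :: "nat \<Rightarrow> mpoly \<Rightarrow> bool" where
  "nonneg_poly n p \<longleftrightarrow> (\<forall>x\<in>vecs n. 0 \<le> eval_poly p x)"

definition total_degree :: "mpoly \<Rightarrow> nat" where
  "total_degree p =
     Max (insert 0 ((\<lambda>a. \<Sum>i\<in>Poly_Mapping.keys a. Poly_Mapping.lookup a i) ` Poly_Mapping.keys p))"

text \<open>
  All finite non-negative combinations. The library's \<open>conic hull\<close> is a different set: it only
  closes under non-negative multiples of single elements.
\<close>

definition nonneg_combinations :: "mpoly set \<Rightarrow> mpoly set" where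
  "nonneg_combinations S =
     {\<Sum>i<k. c i *\<^sub>R s i | (k::nat) (c :: nat \<Rightarrow> real) s. \<forall>i<k. 0 \<le> c i \<and> s i \<in> S}"

text \<open>
  The number of terms in the sums and products below is the number \<open>n\<close> of variables. The exponents
  \<open>\<alpha> i\<close> need not be distinct.
\<close>

definition AHI_poly :: "nat \<Rightarrow> mpoly \<Rightarrow> bool" where
  "AHI_poly n p \<longleftrightarrow>
     (\<exists>(l :: nat \<Rightarrow> real) \<alpha> (c::real).
        (\<forall>i<n. 0 \<le> l i \<and> \<alpha> i \<in> even_vecs n) \<and>
        p = (\<Sum>i<n. l i *\<^sub>R mon (\<alpha> i)) * (\<Sum>i<n. l i *\<^sub>R (\<Prod>j\<in>{..<n} - {i}. mon (\<alpha> j)))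
            - c *\<^sub>R (\<Prod>i<n. mon (\<alpha> i)))"

definition AHI :: "nat \<Rightarrow> mpoly set" where
  "AHI n = {p. AHI_poly n p \<and> nonneg_poly n p}"

definition product_AHI_cone :: "nat \<Rightarrow> mpoly set" where
  "product_AHI_cone n = nonneg_combinations {\<Prod>l<k. q l | (k::nat) q. \<forall>l<k. q l \<in> AHI n}"

definition real_vec :: "expo \<Rightarrow> (nat \<Rightarrow>\<^sub>0 real)" where
  "real_vec a = Poly_Mapping.map real a"

text \<open>
  Since \<open>affine_dependent\<close> is a predicate on sets, affine independence of the family
  \<open>a 0, \<dots>, a m\<close> also requires the \<open>a j\<close> to be distinct.
\<close>

definition circuit_poly :: "nat \<Rightarrow> mpoly \<Rightarrow> bool" where
  "circuit_poly n g \<longleftrightarrow>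
     (\<exists>(m::nat) a (b :: nat \<Rightarrow> real) (c::real) y.
        (\<forall>j\<le>m. a j \<in> even_vecs n \<and> 0 < b j) \<and>
        inj_on a {..m} \<and> \<not> affine_dependent (real_vec ` a ` {..m}) \<and>
        y \<in> vecs n \<and> real_vec y \<in> rel_interior (convex hull (real_vec ` a ` {..m})) \<and>
        g = (\<Sum>j\<le>m. b j *\<^sub>R mon (a j)) + c *\<^sub>R mon y) \<or>
     (\<exists>(b::real) a. 0 < b \<and> a \<in> even_vecs n \<and> g = b *\<^sub>R mon a)"

definition SONC_cone :: "nat \<Rightarrow> nat \<Rightarrow> mpoly set" where
  "SONC_cone n D = nonneg_combinations {g. circuit_poly n g \<and> total_degree g \<le> D \<and> nonneg_poly n g}"

end

theory Submission
  imports Defs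
begin

text \<open>
  The counterexample is \<open>p = (x\<^sup>2 - 1)\<^sup>2 (y\<^sup>2 - 1)\<^sup>2\<close> in two variables. Both factors are AHI polynomials,
  since every square \<open>(A - B)\<^sup>2 = (A + B) (B + A) - 4 A B\<close> with squared monomials \<open>A\<close> and \<open>B\<close> has the
  AHI form (\<open>AHI_square_diff_mon\<close>).

  That \<open>p\<close> is not SONC comes from a convexity property of the zeros of SONC polynomials. On the
  positive orthant, use logarithmic coordinates and divide a circuit polynomial by its inner
  monomial, the only one whose coefficient may be negative. What remains is a positive combination
  of exponentials of linear forms plus a constant, hence a convex function. So if a circuit
  polynomial vanishes at two positive points, it is at most \<open>0\<close> at their coordinatewise geometric
  mean (\<open>circuit_poly_log_midpoint_le_0\<close>). In a sum of non-negative circuit polynomials all summands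
  vanish wherever the sum does, so the property passes to the whole SONC cone
  (\<open>SONC_cone_log_midpoint_le_0\<close>). But \<open>p\<close> vanishes at \<open>(1, 4)\<close> and \<open>(4, 1)\<close>, while at their geometric
  mean \<open>(2, 2)\<close> it takes the value \<open>81\<close>. This argument is independent of any bound on the degree.
\<close>

definition monomial_value :: "(nat \<Rightarrow>\<^sub>0 real) \<Rightarrow> expo \<Rightarrow> real" where
  "monomial_value x a = (\<Prod>i\<in>Poly_Mapping.keys a. Poly_Mapping.lookup x i ^ Poly_Mapping.lookup a i)"

text \<open>
  Products and sums change the supports, so values are compared over a common finite superset of
  the supports involved, where the additional factors are \<open>1\<close> and the additional terms \<open>0\<close>. The same
  device serves for \<open>eval_poly\<close> below.
\<close>

lemma monomial_value_superset:
  assumes "finite S" "Poly_Mapping.keys a \<subseteq> S"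
  shows "monomial_value x a = (\<Prod>i\<in>S. Poly_Mapping.lookup x i ^ Poly_Mapping.lookup a i)"
  unfolding monomial_value_def
  by (rule prod.mono_neutral_left) (use assms in \<open>auto simp: in_keys_iff\<close>)

lemma monomial_value_0 [simp]: "monomial_value x 0 = 1"
  by (simp add: monomial_value_def)

lemma monomial_value_single [simp]:
  "monomial_value x (Poly_Mapping.single i k) = Poly_Mapping.lookup x i ^ k"
  by (simp add: monomial_value_superset [of "{i}"])

lemma monomial_value_add: "monomial_value x (a + b) = monomial_value x a * monomial_value x b"
proof -
  let ?S = "Poly_Mapping.keys a \<union> Poly_Mapping.keys b"
  have "monomial_value x (a + b) = (\<Prod>i\<in>?S. Poly_Mapping.lookup x i ^ Poly_Mapping.lookup (a + b) i)"
    by (rule monomial_value_superset) (auto simp: in_keys_iff lookup_add)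
  also have "\<dots> = monomial_value x a * monomial_value x b"
    by (simp add: monomial_value_superset [of ?S] lookup_add power_add prod.distrib)
  finally show ?thesis .
qed

lemma eval_poly_superset:
  assumes "finite S" "Poly_Mapping.keys p \<subseteq> S"
  shows "eval_poly p x = (\<Sum>a\<in>S. Poly_Mapping.lookup p a * monomial_value x a)"
  unfolding eval_poly_def monomial_value_def [symmetric]
  by (rule sum.mono_neutral_left) (use assms in \<open>auto simp: in_keys_iff\<close>)

lemma eval_poly_single [simp]: "eval_poly (Poly_Mapping.single a c) x = c * monomial_value x a"
  by (simp add: eval_poly_superset [of "{a}"])

lemma eval_poly_mon [simp]: "eval_poly (mon a) x = monomial_value x a"
  by (simp add: mon_def)

lemma eval_poly_add [simp]: "eval_poly (p + q) x = eval_poly p x + eval_poly q x"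
proof -
  let ?S = "Poly_Mapping.keys p \<union> Poly_Mapping.keys q"
  have "eval_poly (p + q) x = (\<Sum>a\<in>?S. Poly_Mapping.lookup (p + q) a * monomial_value x a)"
    by (rule eval_poly_superset) (auto simp: in_keys_iff lookup_add)
  also have "\<dots> = eval_poly p x + eval_poly q x"
    by (simp add: eval_poly_superset [of ?S] lookup_add algebra_simps sum.distrib)
  finally show ?thesis .
qed

lemma lookup_scaleR [simp]:
  "Poly_Mapping.lookup (c *\<^sub>R p) a = c *\<^sub>R Poly_Mapping.lookup p a"
  for p :: "'a \<Rightarrow>\<^sub>0 'b::real_vector"
proof -
  have "finite {i. c *\<^sub>R Poly_Mapping.lookup p i \<noteq> 0}"
    by (rule finite_subset [OF _ finite_lookup [of p]]) auto
  then show ?thesis by (simp add: scaleR_poly_mapping_def)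
qed

lemma eval_poly_scaleR [simp]: "eval_poly (c *\<^sub>R p) x = c * eval_poly p x"
  by (subst (1 2) eval_poly_superset [of "Poly_Mapping.keys p"])
     (auto simp: in_keys_iff sum_distrib_left mult.assoc)

lemma eval_poly_0 [simp]: "eval_poly 0 x = 0"
  by (simp add: eval_poly_def)

lemma eval_poly_diff [simp]: "eval_poly (p - q) x = eval_poly p x - eval_poly q x"
  using eval_poly_add [of "p - q" q x] by simp

lemma eval_poly_sum [simp]: "eval_poly (\<Sum>i\<in>I. f i) x = (\<Sum>i\<in>I. eval_poly (f i) x)"
  by (induction I rule: infinite_finite_induct) simp_all

lemma sum_single_lookup: "(\<Sum>a\<in>Poly_Mapping.keys p. Poly_Mapping.single a (Poly_Mapping.lookup p a)) = p"
  by (rule poly_mapping_eqI) (auto simp: lookup_sum lookup_single when_def in_keys_iff)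

text \<open>
  Evaluation respects products by bilinearity: both factors are sums of single terms, and for single
  terms the claim is the additivity of exponents.
\<close>

lemma eval_poly_mult [simp]: "eval_poly (p * q) x = eval_poly p x * eval_poly q x"
proof -
  let ?t = "\<lambda>p a. Poly_Mapping.single a (Poly_Mapping.lookup p a) :: mpoly"
  have "p * q = (\<Sum>a\<in>Poly_Mapping.keys p. \<Sum>b\<in>Poly_Mapping.keys q. ?t p a * ?t q b)"
    using sum_product [of "?t p" "Poly_Mapping.keys p" "?t q" "Poly_Mapping.keys q"]
    by (simp only: sum_single_lookup)
  then have "eval_poly (p * q) x = (\<Sum>a\<in>Poly_Mapping.keys p. \<Sum>b\<in>Poly_Mapping.keys q.
      eval_poly (?t p a) x * eval_poly (?t q b) x)"
    by (simp add: mult_single monomial_value_add mult_ac)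
  also have "\<dots> = (\<Sum>a\<in>Poly_Mapping.keys p. eval_poly (?t p a) x) *
      (\<Sum>b\<in>Poly_Mapping.keys q. eval_poly (?t q b) x)"
    by (rule sum_product [symmetric])
  also have "\<dots> = eval_poly p x * eval_poly q x"
    by (simp only: eval_poly_sum [symmetric] sum_single_lookup)
  finally show ?thesis .
qed

lemma eval_poly_square [simp]: "eval_poly (p\<^sup>2) x = (eval_poly p x)\<^sup>2"
  by (simp add: power2_eq_square)

text \<open>
  With both weights \<open>1\<close>, the product of the two sums is \<open>(A + B) (B + A)\<close>, and \<open>c = 4\<close> is the largest
  constant that keeps the polynomial non-negative, turning it into \<open>(A - B)\<^sup>2\<close>.
\<close>

lemma AHI_square_diff_mon:
  assumes "a \<in> even_vecs 2" "b \<in> even_vecs 2"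
  shows "(mon a - mon b)\<^sup>2 \<in> AHI 2"
proof -
  define \<alpha> where "\<alpha> = (\<lambda>i::nat. if i = 0 then a else b)"
  \<comment> \<open>Scalar and ring multiplication have to be identified before the ring normalizer can be used.\<close>
  have four: "4 *\<^sub>R q = 4 * q" for q :: mpoly
  proof -
    have "4 *\<^sub>R q = (1 + 1 + 1 + 1) *\<^sub>R q" by simp
    also have "\<dots> = 4 * q" by (simp only: scaleR_left_distrib scaleR_one) (simp add: algebra_simps)
    finally show ?thesis .
  qed
  have "{..<2} - {0} = {1::nat}" "{..<2} - {1} = {0::nat}" "{..<2} - {Suc 0} = {0::nat}" by auto
  then have "(mon a - mon b)\<^sup>2 = (\<Sum>i<2. 1 *\<^sub>R mon (\<alpha> i)) *
      (\<Sum>i<2. 1 *\<^sub>R (\<Prod>j\<in>{..<2} - {i}. mon (\<alpha> j))) - 4 *\<^sub>R (\<Prod>i<2. mon (\<alpha> i))"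
    by (simp add: four \<alpha>_def numeral_2_eq_2 lessThan_Suc) (simp add: algebra_simps)
  moreover have "\<forall>i<2. (0::real) \<le> 1 \<and> \<alpha> i \<in> even_vecs 2"
    using assms by (simp add: \<alpha>_def)
  ultimately have "AHI_poly 2 ((mon a - mon b)\<^sup>2)"
    unfolding AHI_poly_def by (intro exI conjI)
  then show ?thesis by (simp add: AHI_def nonneg_poly_def)
qed

text \<open>
  The first \<open>n\<close> coordinates of \<open>w\<close> are positive and the geometric means of those of \<open>x\<close> and \<open>z\<close>, so that \<open>w\<close> is
  the midpoint of \<open>x\<close> and \<open>z\<close> in logarithmic coordinates. Stating this by squares keeps square roots
  and logarithms out of the proofs.
\<close>

definition log_midpoint :: "nat \<Rightarrow> (nat \<Rightarrow>\<^sub>0 real) \<Rightarrow> (nat \<Rightarrow>\<^sub>0 real) \<Rightarrow> (nat \<Rightarrow>\<^sub>0 real) \<Rightarrow> bool" where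
  "log_midpoint n x z w \<longleftrightarrow>
     (\<forall>i<n. 0 < Poly_Mapping.lookup x i \<and> 0 < Poly_Mapping.lookup z i \<and> 0 < Poly_Mapping.lookup w i \<and>
        (Poly_Mapping.lookup w i)\<^sup>2 = Poly_Mapping.lookup x i * Poly_Mapping.lookup z i)"

lemma log_midpoint_monomial:
  assumes "log_midpoint n x z w" "a \<in> vecs n"
  shows "0 < monomial_value x a" "0 < monomial_value z a" "0 < monomial_value w a"
    "(monomial_value w a)\<^sup>2 = monomial_value x a * monomial_value z a"
proof -
  have *: "i < n" if "i \<in> Poly_Mapping.keys a" for i
    using assms(2) that by (auto simp: vecs_def)
  show "0 < monomial_value x a" "0 < monomial_value z a" "0 < monomial_value w a"
    using assms(1) * unfolding monomial_value_def log_midpoint_def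
    by (auto intro!: prod_pos zero_less_power)
  have "((Poly_Mapping.lookup w i) ^ k)\<^sup>2 = Poly_Mapping.lookup x i ^ k * Poly_Mapping.lookup z i ^ k"
    if "i \<in> Poly_Mapping.keys a" for i k
  proof -
    have "((Poly_Mapping.lookup w i) ^ k)\<^sup>2 = ((Poly_Mapping.lookup w i)\<^sup>2) ^ k"
      by (simp add: power_mult [symmetric] mult.commute)
    then show ?thesis
      using assms(1) *[OF that] by (simp add: log_midpoint_def power_mult_distrib)
  qed
  then show "(monomial_value w a)\<^sup>2 = monomial_value x a * monomial_value z a"
    by (simp add: monomial_value_def prod_power_distrib prod.distrib [symmetric])
qed

text \<open>
  A quotient of two monomials is the exponential of a linear form in logarithmic coordinates. Its
  midpoint convexity is the inequality between the arithmetic and the geometric mean.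
\<close>

lemma log_midpoint_monomial_ratio:
  assumes "log_midpoint n x z w" "a \<in> vecs n" "y \<in> vecs n"
  shows "2 * (monomial_value w a / monomial_value w y) \<le>
    monomial_value x a / monomial_value x y + monomial_value z a / monomial_value z y"
    (is "2 * ?w \<le> ?x + ?z")
proof (rule power2_le_imp_le)
  note a = log_midpoint_monomial [OF assms(1,2)]
  note y = log_midpoint_monomial [OF assms(1,3)]
  have "?w\<^sup>2 = ?x * ?z" by (simp add: power_divide a(4) y(4))
  then have "(2 * ?w)\<^sup>2 = 4 * (?x * ?z)" unfolding power_mult_distrib by simp
  also have "\<dots> \<le> (?x + ?z)\<^sup>2"
    using zero_le_power2 [of "?x - ?z"] by (simp only: power2_sum power2_diff)
  finally show "(2 * ?w)\<^sup>2 \<le> (?x + ?z)\<^sup>2" .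
  show "0 \<le> ?x + ?z" using a y by simp
qed

text \<open>
  After division by the inner monomial, the sign of \<open>c\<close> is harmless: the inner term becomes
  the constant \<open>c\<close>, and the outer terms are positive multiples of quotients of monomials.
  Midpoint convexity of these quotients therefore gives that of the whole function. A monomial
  square, the degenerate case, has no zero at a positive point.
\<close>

lemma circuit_poly_log_midpoint_le_0:
  assumes circuit: "circuit_poly n g" and mid: "log_midpoint n x z w"
    and zeros: "eval_poly g x = 0" "eval_poly g z = 0"
  shows "eval_poly g w \<le> 0"
  using circuit unfolding circuit_poly_def
proof (elim disjE exE conjE)
  fix m a and b :: "nat \<Rightarrow> real" and c :: real and y
  assume pos: "\<forall>j\<le>m. a j \<in> even_vecs n \<and> 0 < b j" and y: "y \<in> vecs n"
    and g: "g = (\<Sum>j\<le>m. b j *\<^sub>R mon (a j)) + c *\<^sub>R mon y"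
  note pos_y = log_midpoint_monomial [OF mid y]
  have quotient: "eval_poly g v / monomial_value v y =
      (\<Sum>j\<le>m. b j * (monomial_value v (a j) / monomial_value v y)) + c"
    if "0 < monomial_value v y" for v
    using that by (simp add: g add_divide_distrib sum_divide_distrib)
  have "2 * (\<Sum>j\<le>m. b j * (monomial_value w (a j) / monomial_value w y)) \<le>
      (\<Sum>j\<le>m. b j * (monomial_value x (a j) / monomial_value x y)) +
      (\<Sum>j\<le>m. b j * (monomial_value z (a j) / monomial_value z y))"
    unfolding sum_distrib_left sum.distrib [symmetric]
  proof (rule sum_mono)
    fix j assume "j \<in> {..m}"
    then have "a j \<in> vecs n" "0 \<le> b j" using pos by (auto simp: even_vecs_def less_imp_le)
    from mult_left_mono [OF log_midpoint_monomial_ratio [OF mid this(1) y] this(2)]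
    show "2 * (b j * (monomial_value w (a j) / monomial_value w y)) \<le>
        b j * (monomial_value x (a j) / monomial_value x y) +
        b j * (monomial_value z (a j) / monomial_value z y)"
      by (simp only: distrib_left mult.left_commute)
  qed
  then have "2 * (eval_poly g w / monomial_value w y) \<le>
      eval_poly g x / monomial_value x y + eval_poly g z / monomial_value z y"
    unfolding quotient [OF pos_y(1)] quotient [OF pos_y(2)] quotient [OF pos_y(3)]
    by (simp only: distrib_left)
  then show "eval_poly g w \<le> 0"
    using pos_y(3) by (simp add: zeros divide_le_0_iff)
next
  fix b :: real and a assume "0 < b" "a \<in> even_vecs n" "g = b *\<^sub>R mon a"
  moreover from this have "0 < monomial_value x a"
    using log_midpoint_monomial(1) [OF mid] by (simp add: even_vecs_def)
  ultimately show ?thesis using zeros(1) by simp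
qed

text \<open>
  The summands are non-negative at \<open>x\<close> and \<open>z\<close>, so none of them can be positive there when the sum
  is \<open>0\<close>. Thus every circuit polynomial with a positive coefficient inherits both zeros.
\<close>

lemma SONC_cone_log_midpoint_le_0:
  assumes "p \<in> SONC_cone n D" and mid: "log_midpoint n x z w"
    and vecs: "x \<in> vecs n" "z \<in> vecs n"
    and zeros: "eval_poly p x = 0" "eval_poly p z = 0"
  shows "eval_poly p w \<le> 0"
proof -
  obtain k and c :: "nat \<Rightarrow> real" and s
    where p: "p = (\<Sum>i<k. c i *\<^sub>R s i)" and c: "\<And>i. i < k \<Longrightarrow> 0 \<le> c i"
      and circuit: "\<And>i. i < k \<Longrightarrow> circuit_poly n (s i)"
      and nonneg: "\<And>i. i < k \<Longrightarrow> nonneg_poly n (s i)"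
    using assms(1) unfolding SONC_cone_def nonneg_combinations_def by blast
  have summand: "c i * eval_poly (s i) v = 0" if "i < k" "v \<in> vecs n" "eval_poly p v = 0" for i v
  proof -
    have "\<forall>i\<in>{..<k}. c i * eval_poly (s i) v = 0"
      by (subst sum_nonneg_eq_0_iff [symmetric])
         (use that c nonneg in \<open>auto simp: p nonneg_poly_def\<close>)
    then show ?thesis using that(1) by simp
  qed
  have "c i * eval_poly (s i) w \<le> 0" if i: "i < k" for i
  proof (cases "c i = 0")
    case False
    then have "eval_poly (s i) x = 0" "eval_poly (s i) z = 0"
      using summand [OF i vecs(1) zeros(1)] summand [OF i vecs(2) zeros(2)] by simp_all
    from circuit_poly_log_midpoint_le_0 [OF circuit [OF i] mid this] show ?thesis
      using c [OF i] by (simp add: mult_nonneg_nonpos)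
  qed simp
  then show ?thesis by (auto simp: p intro!: sum_nonpos)
qed

theorem theorem4p8:
  shows "\<exists>n d. \<exists>p\<in>product_AHI_cone n. total_degree p \<le> 2 * d \<and> p \<notin> SONC_cone n (2 * d)"
proof -
  define q where "q = (\<lambda>i::nat. (mon (Poly_Mapping.single i 2) - mon 0)\<^sup>2)"
  define p where "p = q 0 * q 1"
  define pt where "pt = (\<lambda>s t::real. Poly_Mapping.single (0::nat) s + Poly_Mapping.single 1 t)"
  have eval_p: "eval_poly p (pt s t) = (s\<^sup>2 - 1)\<^sup>2 * (t\<^sup>2 - 1)\<^sup>2" for s t
    by (simp add: p_def q_def pt_def lookup_add lookup_single when_def del: single_numeral)
  have "q i \<in> AHI 2" if "i < 2" for i
    unfolding q_def by (rule AHI_square_diff_mon) (use that in \<open>auto simp: even_vecs_def vecs_def lookup_single when_def\<close>)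
  then have "p \<in> {\<Prod>l<k. r l | (k::nat) r. \<forall>l<k. r l \<in> AHI 2}"
    by (intro CollectI exI [of _ 2] exI [of _ q]) (simp add: p_def numeral_2_eq_2)
  then have "p \<in> product_AHI_cone 2"
    unfolding product_AHI_cone_def nonneg_combinations_def
    by (intro CollectI exI [of _ 1] exI [of _ "\<lambda>_. 1"] exI [of _ "\<lambda>_. p"]) simp
  moreover have "p \<notin> SONC_cone 2 D" for D
  proof
    assume "p \<in> SONC_cone 2 D"
    moreover have "pt s t \<in> vecs 2" for s t
      by (auto simp: vecs_def pt_def dest!: subsetD [OF keys_add] split: if_splits)
    moreover have "log_midpoint 2 (pt 1 4) (pt 4 1) (pt 2 2)"
      by (auto simp: log_midpoint_def pt_def lookup_add lookup_single when_def less_2_cases_iff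
          simp del: single_numeral single_one)
    ultimately have "eval_poly p (pt 2 2) \<le> 0"
      using SONC_cone_log_midpoint_le_0 [of p 2 D "pt 1 4" "pt 4 1" "pt 2 2"]
      by (simp add: eval_p)
    then show False by (simp add: eval_p)
  qed
  \<comment> \<open>Since no degree bound \<open>D\<close> helps, any \<open>d\<close> that is large enough for \<open>p\<close> will do.\<close>
  moreover have "total_degree p \<le> 2 * total_degree p" by simp
  ultimately show ?thesis by blast
qed

end
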